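(* Let $R$ be a TAF-ring. Then every factor ring $R/I$ ($I$ an ideal of $R$) is a TAF-ring, and every fraction ring $S^{-1}R$ ($S$ a multiplicative subset of $R$) is a TAF-ring.
   Context: All rings are commutative with identity. An ideal $I$ of a ring $R$ is a 2-absorbing ideal (TA-ideal) if whenever $a,b,c\in R$ and $abc\in I$, then $ab\in I$ or $ac\in I$ or $bc\in I$. A TA-factorization of an ideal $I$ is an expression $I=J_1\cdots J_n$ as a product of proper TA-ideals. $R$ is a TAF-ring if every proper ideal of $R$ has a TA-factorization. *)

theory Defs
  imports "HOL-Algebra.QuotRing" "HOL-Algebra.Ideal_Product"
begin

section \<open>TAF-rings\<close>

definition TA_ideal :: "'a set \<Rightarrow> ('a, 'b) ring_scheme \<Rightarrow> bool" where
  "TA_ideal I R \<longleftrightarrow> ideal I R \<and>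
     (\<forall>a\<in>carrier R. \<forall>b\<in>carrier R. \<forall>c\<in>carrier R.
        a \<otimes>\<^bsub>R\<^esub> b \<otimes>\<^bsub>R\<^esub> c \<in> I \<longrightarrow> a \<otimes>\<^bsub>R\<^esub> b \<in> I \<or> a \<otimes>\<^bsub>R\<^esub> c \<in> I \<or> b \<otimes>\<^bsub>R\<^esub> c \<in> I)"

text \<open>The unit ideal \<open>carrier R\<close>, with which the fold starts, is neutral for the product of
  ideals, so the fold computes \<open>J\<^sub>1 \<cdots> J\<^sub>n\<close> for the list \<open>[J\<^sub>1, \<dots>, J\<^sub>n]\<close>.\<close>

definition TA_factorization :: "('a, 'b) ring_scheme \<Rightarrow> 'a set \<Rightarrow> 'a set list \<Rightarrow> bool" where
  "TA_factorization R I Js \<longleftrightarrow>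
     Js \<noteq> [] \<and> (\<forall>J\<in>set Js. TA_ideal J R \<and> J \<noteq> carrier R) \<and>
     I = foldr (ideal_prod R) Js (carrier R)"

text \<open>The zero ring counts as a TAF-ring, as it has no proper ideals.\<close>

definition TAF_ring :: "('a, 'b) ring_scheme \<Rightarrow> bool" where
  "TAF_ring R \<longleftrightarrow> cring R \<and>
     (\<forall>I. ideal I R \<and> I \<noteq> carrier R \<longrightarrow> (\<exists>Js. TA_factorization R I Js))"


section \<open>Rings of fractions\<close>

text \<open>Below, \<open>S\<close> is meant to be a multiplicative subset of \<open>R\<close>, that is, \<open>submonoid S R\<close>.
  It may contain zero divisors, hence the additional factor \<open>u\<close> in the relation; it may also
  contain zero, in which case the ring of fractions is the zero ring.\<close>

definition frac_rel :: "('a, 'b) ring_scheme \<Rightarrow> 'a set \<Rightarrow> (('a \<times> 'a) \<times> ('a \<times> 'a)) set" where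
  "frac_rel R S = {((a, s), (b, t)). a \<in> carrier R \<and> s \<in> S \<and> b \<in> carrier R \<and> t \<in> S \<and>
     (\<exists>u\<in>S. u \<otimes>\<^bsub>R\<^esub> (t \<otimes>\<^bsub>R\<^esub> a \<ominus>\<^bsub>R\<^esub> s \<otimes>\<^bsub>R\<^esub> b) = \<zero>\<^bsub>R\<^esub>)}"

definition frac :: "('a, 'b) ring_scheme \<Rightarrow> 'a set \<Rightarrow> 'a \<Rightarrow> 'a \<Rightarrow> ('a \<times> 'a) set" where
  "frac R S a s = frac_rel R S `` {(a, s)}"

text \<open>The unions in the operations range over all representatives of the two fractions; they are
  unions of one and the same class (lemmas \<open>mult_frac\<close> and \<open>add_frac\<close> below).\<close>

definition fraction_ring :: "('a, 'b) ring_scheme \<Rightarrow> 'a set \<Rightarrow> ('a \<times> 'a) set ring" where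
  "fraction_ring R S =
    \<lparr>carrier = (carrier R \<times> S) // frac_rel R S,
     mult = (\<lambda>X Y. \<Union>(a, s)\<in>X. \<Union>(b, t)\<in>Y. frac R S (a \<otimes>\<^bsub>R\<^esub> b) (s \<otimes>\<^bsub>R\<^esub> t)),
     one = frac R S \<one>\<^bsub>R\<^esub> \<one>\<^bsub>R\<^esub>,
     zero = frac R S \<zero>\<^bsub>R\<^esub> \<one>\<^bsub>R\<^esub>,
     add = (\<lambda>X Y. \<Union>(a, s)\<in>X. \<Union>(b, t)\<in>Y.
              frac R S (t \<otimes>\<^bsub>R\<^esub> a \<oplus>\<^bsub>R\<^esub> s \<otimes>\<^bsub>R\<^esub> b) (s \<otimes>\<^bsub>R\<^esub> t))\<rparr>"

context
  fixes R (structure) and S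
  assumes R: "cring R" and S: "submonoid S R"
begin

interpretation cring R by (rule R)
interpretation S: submonoid S R by (rule S)

lemma frac_rel_iff:
  "((a, s), (b, t)) \<in> frac_rel R S \<longleftrightarrow> a \<in> carrier R \<and> s \<in> S \<and> b \<in> carrier R \<and> t \<in> S \<and>
     (\<exists>u\<in>S. u \<otimes> (t \<otimes> a) = u \<otimes> (s \<otimes> b))"
proof -
  have "u \<otimes> (t \<otimes> a \<ominus> s \<otimes> b) = \<zero> \<longleftrightarrow> u \<otimes> (t \<otimes> a) = u \<otimes> (s \<otimes> b)"
    if "a \<in> carrier R" "b \<in> carrier R" "s \<in> S" "t \<in> S" "u \<in> S" for u
    using that by (simp add: minus_eq r_distr r_minus) (metis S.mem_carrier m_closed minus_equality minus_minus r_neg a_inv_closed)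
  then show ?thesis unfolding frac_rel_def by (simp, blast)
qed

lemma equiv_frac_rel: "equiv (carrier R \<times> S) (frac_rel R S)"
proof (rule equivI)
  show "frac_rel R S \<subseteq> (carrier R \<times> S) \<times> (carrier R \<times> S)"
    by (auto simp: frac_rel_def)
  show "refl_on (carrier R \<times> S) (frac_rel R S)"
    by (rule refl_onI) (use S.one_closed in \<open>auto simp: frac_rel_iff\<close>)
  show "sym (frac_rel R S)"
    by (rule symI) (clarsimp simp: frac_rel_iff, metis)
  show "trans (frac_rel R S)"
  proof (rule transI, clarify)
    fix a s b t c r
    assume "((a, s), (b, t)) \<in> frac_rel R S" "((b, t), (c, r)) \<in> frac_rel R S"
    then obtain u v where c: "a \<in> carrier R" "b \<in> carrier R" "c \<in> carrier R"
        "s \<in> S" "t \<in> S" "r \<in> S" "u \<in> S" "v \<in> S"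
      and u: "u \<otimes> (t \<otimes> a) = u \<otimes> (s \<otimes> b)" and v: "v \<otimes> (r \<otimes> b) = v \<otimes> (t \<otimes> c)"
      by (auto simp: frac_rel_iff)
    have "(u \<otimes> v \<otimes> t) \<otimes> (r \<otimes> a) = v \<otimes> r \<otimes> (u \<otimes> (t \<otimes> a))" using c by (simp add: m_ac)
    also have "\<dots> = u \<otimes> s \<otimes> (v \<otimes> (r \<otimes> b))" unfolding u using c by (simp add: m_ac)
    also have "\<dots> = (u \<otimes> v \<otimes> t) \<otimes> (s \<otimes> c)" unfolding v using c by (simp add: m_ac)
    finally show "((a, s), (c, r)) \<in> frac_rel R S"
      using c by (auto simp: frac_rel_iff intro!: bexI[of _ "u \<otimes> v \<otimes> t"])
  qed
qed

lemma frac_eq_iff: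
  assumes "a \<in> carrier R" "s \<in> S" "b \<in> carrier R" "t \<in> S"
  shows "frac R S a s = frac R S b t \<longleftrightarrow> (\<exists>u\<in>S. u \<otimes> (t \<otimes> a) = u \<otimes> (s \<otimes> b))"
  using eq_equiv_class_iff[OF equiv_frac_rel, of "(a, s)" "(b, t)"] assms
  by (simp add: frac_def frac_rel_iff)

lemma mult_frac:
  assumes "a \<in> carrier R" "s \<in> S" "b \<in> carrier R" "t \<in> S"
  shows "frac R S a s \<otimes>\<^bsub>fraction_ring R S\<^esub> frac R S b t = frac R S (a \<otimes> b) (s \<otimes> t)"
proof -
  have "(\<lambda>(a, s) (b, t). frac R S (a \<otimes> b) (s \<otimes> t)) respects2 frac_rel R S"
  proof (rule congruent2I', clarify)
    fix a1 s1 a2 s2 b1 t1 b2 t2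
    assume "((a1, s1), (a2, s2)) \<in> frac_rel R S" "((b1, t1), (b2, t2)) \<in> frac_rel R S"
    then obtain u v where c: "a1 \<in> carrier R" "a2 \<in> carrier R" "b1 \<in> carrier R" "b2 \<in> carrier R"
        "s1 \<in> S" "s2 \<in> S" "t1 \<in> S" "t2 \<in> S" "u \<in> S" "v \<in> S"
      and u: "u \<otimes> (s2 \<otimes> a1) = u \<otimes> (s1 \<otimes> a2)" and v: "v \<otimes> (t2 \<otimes> b1) = v \<otimes> (t1 \<otimes> b2)"
      by (auto simp: frac_rel_iff)
    have "u \<otimes> v \<otimes> (s2 \<otimes> t2 \<otimes> (a1 \<otimes> b1)) = (u \<otimes> (s2 \<otimes> a1)) \<otimes> (v \<otimes> (t2 \<otimes> b1))"
      using c by (simp add: m_ac)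
    also have "\<dots> = u \<otimes> v \<otimes> (s1 \<otimes> t1 \<otimes> (a2 \<otimes> b2))"
      unfolding u v using c by (simp add: m_ac)
    finally show "frac R S (a1 \<otimes> b1) (s1 \<otimes> t1) = frac R S (a2 \<otimes> b2) (s2 \<otimes> t2)"
      using c by (auto simp: frac_eq_iff intro!: bexI[of _ "u \<otimes> v"])
  qed
  from UN_equiv_class2[OF equiv_frac_rel equiv_frac_rel this, of "(a, s)" "(b, t)"] assms
  show ?thesis by (simp add: fraction_ring_def frac_def[of _ _ a s] frac_def[of _ _ b t] split_def)
qed

lemma add_frac:
  assumes "a \<in> carrier R" "s \<in> S" "b \<in> carrier R" "t \<in> S"
  shows "frac R S a s \<oplus>\<^bsub>fraction_ring R S\<^esub> frac R S b t = frac R S (t \<otimes> a \<oplus> s \<otimes> b) (s \<otimes> t)"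
proof -
  have "(\<lambda>(a, s) (b, t). frac R S (t \<otimes> a \<oplus> s \<otimes> b) (s \<otimes> t)) respects2 frac_rel R S"
  proof (rule congruent2I', clarify)
    fix a1 s1 a2 s2 b1 t1 b2 t2
    assume "((a1, s1), (a2, s2)) \<in> frac_rel R S" "((b1, t1), (b2, t2)) \<in> frac_rel R S"
    then obtain u v where c: "a1 \<in> carrier R" "a2 \<in> carrier R" "b1 \<in> carrier R" "b2 \<in> carrier R"
        "s1 \<in> S" "s2 \<in> S" "t1 \<in> S" "t2 \<in> S" "u \<in> S" "v \<in> S"
      and u: "u \<otimes> (s2 \<otimes> a1) = u \<otimes> (s1 \<otimes> a2)" and v: "v \<otimes> (t2 \<otimes> b1) = v \<otimes> (t1 \<otimes> b2)"
      by (auto simp: frac_rel_iff)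
    have "u \<otimes> v \<otimes> (s2 \<otimes> t2 \<otimes> (t1 \<otimes> a1 \<oplus> s1 \<otimes> b1)) =
        v \<otimes> t1 \<otimes> t2 \<otimes> (u \<otimes> (s2 \<otimes> a1)) \<oplus> u \<otimes> s1 \<otimes> s2 \<otimes> (v \<otimes> (t2 \<otimes> b1))"
      using c by (simp add: m_ac r_distr)
    also have "\<dots> = u \<otimes> v \<otimes> (s1 \<otimes> t1 \<otimes> (t2 \<otimes> a2 \<oplus> s2 \<otimes> b2))"
      unfolding u v using c by (simp add: m_ac r_distr)
    finally show "frac R S (t1 \<otimes> a1 \<oplus> s1 \<otimes> b1) (s1 \<otimes> t1) =
        frac R S (t2 \<otimes> a2 \<oplus> s2 \<otimes> b2) (s2 \<otimes> t2)"
      using c by (auto simp: frac_eq_iff intro!: bexI[of _ "u \<otimes> v"])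
  qed
  from UN_equiv_class2[OF equiv_frac_rel equiv_frac_rel this, of "(a, s)" "(b, t)"] assms
  show ?thesis by (simp add: fraction_ring_def frac_def[of _ _ a s] frac_def[of _ _ b t] split_def)
qed

lemma frac_closed:
  "a \<in> carrier R \<Longrightarrow> s \<in> S \<Longrightarrow> frac R S a s \<in> carrier (fraction_ring R S)"
  by (simp add: fraction_ring_def frac_def quotientI)

lemma carrier_fraction_ring_cases:
  assumes "X \<in> carrier (fraction_ring R S)"
  obtains a s where "a \<in> carrier R" "s \<in> S" "X = frac R S a s"
  using assms by (auto simp: fraction_ring_def frac_def elim!: quotientE)

lemma cring_fraction_ring: "cring (fraction_ring R S)"
proof -
  let ?F = "fraction_ring R S"
  have one: "\<one>\<^bsub>?F\<^esub> = frac R S \<one> \<one>" and zero: "\<zero>\<^bsub>?F\<^esub> = frac R S \<zero> \<one>"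
    by (simp_all add: fraction_ring_def)
  show ?thesis
  proof (rule cringI)
    show "abelian_group ?F"
    proof (rule abelian_groupI)
      fix X assume "X \<in> carrier ?F"
      then obtain a s where "a \<in> carrier R" "s \<in> S" "X = frac R S a s"
        by (rule carrier_fraction_ring_cases)
      then have "frac R S (\<ominus> a) s \<in> carrier ?F \<and> frac R S (\<ominus> a) s \<oplus>\<^bsub>?F\<^esub> X = \<zero>\<^bsub>?F\<^esub>"
        by (simp add: frac_closed add_frac zero r_minus l_neg frac_eq_iff)
          (use S.one_closed in blast)
      then show "\<exists>Y\<in>carrier ?F. Y \<oplus>\<^bsub>?F\<^esub> X = \<zero>\<^bsub>?F\<^esub>" by blast
    qed (auto elim!: carrier_fraction_ring_cases
           simp: add_frac zero frac_closed m_ac a_ac r_distr)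
    show "comm_monoid ?F"
      by (rule comm_monoidI)
        (auto elim!: carrier_fraction_ring_cases simp: mult_frac one frac_closed m_ac)
    show "(X \<oplus>\<^bsub>?F\<^esub> Y) \<otimes>\<^bsub>?F\<^esub> Z = X \<otimes>\<^bsub>?F\<^esub> Z \<oplus>\<^bsub>?F\<^esub> Y \<otimes>\<^bsub>?F\<^esub> Z"
      if "X \<in> carrier ?F" "Y \<in> carrier ?F" "Z \<in> carrier ?F" for X Y Z
    proof -
      from that obtain a s b t c r
        where c: "a \<in> carrier R" "s \<in> S" "b \<in> carrier R" "t \<in> S" "c \<in> carrier R" "r \<in> S"
          and eq: "X = frac R S a s" "Y = frac R S b t" "Z = frac R S c r"
        by (elim carrier_fraction_ring_cases)
      show ?thesis
        unfolding eq using c S.one_closed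
        by (simp add: add_frac mult_frac frac_eq_iff, intro bexI[of _ \<one>])
          (simp_all add: m_ac r_distr)
    qed
  qed
qed

end

end

theory Submission
  imports Defs
begin

text \<open>Both \<open>R \<rightarrow> R/I\<close> and \<open>R \<rightarrow> S\<^sup>-\<^sup>1R\<close> are homomorphisms \<open>h\<close> for which every element of the
  target becomes an element of \<open>h(R)\<close> after multiplication by some unit \<open>h(s)\<close>. For such \<open>h\<close>,
  every ideal is the extension of its contraction, extension commutes with products, and the
  extension of a TA-ideal containing the kernel is a TA-ideal or the unit ideal. Given a
  TA-factorization of the contraction of a proper ideal, its factors contain the contraction and
  hence the kernel, so their proper extensions yield a TA-factorization of the ideal itself.\<close>

section \<open>Finite products of ideals\<close>

lemma (in cring) ideal_foldr_ideal_prod: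
  assumes "\<And>J. J \<in> set Js \<Longrightarrow> ideal J R"
  shows "ideal (foldr (ideal_prod R) Js (carrier R)) R"
  using assms by (induction Js) (auto intro: ideal_prod_is_ideal oneideal)

text \<open>A product of two ideals lies in their intersection, so induction reaches every factor.
  This is what passes the kernel from a contracted ideal on to the factors of its
  factorization.\<close>

lemma (in cring) foldr_ideal_prod_subset:
  assumes "\<And>J. J \<in> set Js \<Longrightarrow> ideal J R" and "J \<in> set Js"
  shows "foldr (ideal_prod R) Js (carrier R) \<subseteq> J"
  using assms
proof (induction Js)
  case (Cons K Js)
  have "ideal K R" "ideal (foldr (ideal_prod R) Js (carrier R)) R"
    using Cons.prems by (auto intro: ideal_foldr_ideal_prod)
  then have "foldr (ideal_prod R) (K # Js) (carrier R)
      \<subseteq> K \<inter> foldr (ideal_prod R) Js (carrier R)"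
    using ideal_prod_inter by simp
  then show ?case using Cons by auto
qed simp

lemma (in cring) foldr_ideal_prod_filter:
  assumes "\<And>J. J \<in> set Js \<Longrightarrow> ideal J R"
  shows "foldr (ideal_prod R) (filter (\<lambda>J. J \<noteq> carrier R) Js) (carrier R)
    = foldr (ideal_prod R) Js (carrier R)"
  using assms
  by (induction Js)
    (auto simp: ideal_prod_one ideal_prod_commute[OF oneideal] ideal_foldr_ideal_prod)

section \<open>Extension and contraction of ideals along a homomorphism with denominators\<close>

locale fraction_hom = ring_hom_cring +
  assumes ex_denominator:
    "x \<in> carrier S \<Longrightarrow> \<exists>s\<in>carrier R. h s \<in> Units S \<and> (\<exists>r\<in>carrier R. h s \<otimes>\<^bsub>S\<^esub> x = h r)"
begin

text \<open>Here \<open>S\<close> is the target ring, not a multiplicative subset. For an ideal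
  \<open>J\<close> this set is the ideal of \<open>S\<close> generated by the image of
  \<open>J\<close>: common denominators turn a sum of multiples of elements \<open>h j\<close> into
  a single fraction.\<close>

definition extension :: "'a set \<Rightarrow> 'c set" where
  "extension J = {x \<in> carrier S. \<exists>s\<in>carrier R. h s \<in> Units S \<and> (\<exists>j\<in>J. h s \<otimes>\<^bsub>S\<^esub> x = h j)}"

definition contraction :: "'c set \<Rightarrow> 'a set" where
  "contraction J = {r \<in> carrier R. h r \<in> J}"

lemma extensionE:
  assumes "x \<in> extension J"
  obtains s j where "x \<in> carrier S" "s \<in> carrier R" "h s \<in> Units S" "j \<in> J" "h s \<otimes>\<^bsub>S\<^esub> x = h j"
  using assms by (auto simp: extension_def)

lemma extensionI:
  assumes "x \<in> carrier S" "s \<in> carrier R" "h s \<in> Units S" "j \<in> J" "h s \<otimes>\<^bsub>S\<^esub> x = h j"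
  shows "x \<in> extension J"
  using assms by (auto simp: extension_def)

lemma denominatorE:
  assumes "x \<in> carrier S"
  obtains s r where "s \<in> carrier R" "h s \<in> Units S" "r \<in> carrier R" "h s \<otimes>\<^bsub>S\<^esub> x = h r"
  using ex_denominator[OF assms] by blast

lemma mem_ideal_unit_cancel:
  assumes "ideal I S" "u \<in> Units S" "x \<in> carrier S" "u \<otimes>\<^bsub>S\<^esub> x \<in> I"
  shows "x \<in> I"
proof -
  have "inv\<^bsub>S\<^esub> u \<otimes>\<^bsub>S\<^esub> (u \<otimes>\<^bsub>S\<^esub> x) \<in> I"
    by (rule ideal.I_l_closed) (use assms in auto)
  also have "inv\<^bsub>S\<^esub> u \<otimes>\<^bsub>S\<^esub> (u \<otimes>\<^bsub>S\<^esub> x) = x"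
    using assms by (simp add: S.m_assoc[symmetric] S.Units_closed)
  finally show ?thesis .
qed

text \<open>If \<open>s\<close> and \<open>t\<close> are denominators of two elements, then
  \<open>s \<otimes> t\<close> is a denominator of both their sum and their product, and the
  resulting numerator stays in \<open>J\<close>.\<close>

lemma ideal_extension:
  assumes "ideal J R"
  shows "ideal (extension J) S"
proof -
  interpret J: ideal J R by fact
  have mult: "a \<otimes>\<^bsub>S\<^esub> x \<in> extension J" if xJ: "x \<in> extension J" and aS: "a \<in> carrier S" for a x
  proof -
    obtain s j where x: "x \<in> carrier S" "s \<in> carrier R" "h s \<in> Units S" "j \<in> J"
        "h s \<otimes>\<^bsub>S\<^esub> x = h j"
      using xJ by (rule extensionE)
    obtain t r where a: "t \<in> carrier R" "h t \<in> Units S" "r \<in> carrier R" "h t \<otimes>\<^bsub>S\<^esub> a = h r"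
      using aS by (rule denominatorE)
    have "h (s \<otimes> t) \<otimes>\<^bsub>S\<^esub> (a \<otimes>\<^bsub>S\<^esub> x) = (h t \<otimes>\<^bsub>S\<^esub> a) \<otimes>\<^bsub>S\<^esub> (h s \<otimes>\<^bsub>S\<^esub> x)"
      using x(1,2) a(1) aS by (simp add: S.m_ac)
    also have "\<dots> = h (r \<otimes> j)" using x a by simp
    finally show ?thesis
      using x a aS J.I_l_closed[of j r] by (intro extensionI[of _ "s \<otimes> t" "r \<otimes> j"]) auto
  qed
  have add: "x \<oplus>\<^bsub>S\<^esub> y \<in> extension J" if xJ: "x \<in> extension J" and yJ: "y \<in> extension J" for x y
  proof -
    obtain s i where x: "x \<in> carrier S" "s \<in> carrier R" "h s \<in> Units S" "i \<in> J"
        "h s \<otimes>\<^bsub>S\<^esub> x = h i"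
      using xJ by (rule extensionE)
    obtain t j where y: "y \<in> carrier S" "t \<in> carrier R" "h t \<in> Units S" "j \<in> J"
        "h t \<otimes>\<^bsub>S\<^esub> y = h j"
      using yJ by (rule extensionE)
    have "h (s \<otimes> t) \<otimes>\<^bsub>S\<^esub> (x \<oplus>\<^bsub>S\<^esub> y)
        = h t \<otimes>\<^bsub>S\<^esub> (h s \<otimes>\<^bsub>S\<^esub> x) \<oplus>\<^bsub>S\<^esub> h s \<otimes>\<^bsub>S\<^esub> (h t \<otimes>\<^bsub>S\<^esub> y)"
      using x(1,2) y(1,2) by (simp add: S.m_ac S.r_distr)
    also have "\<dots> = h (t \<otimes> i \<oplus> s \<otimes> j)" using x y by simp
    finally show ?thesis
      using x y J.I_l_closed by (intro extensionI[of _ "s \<otimes> t" "t \<otimes> i \<oplus> s \<otimes> j"]) auto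
  qed
  have zero: "\<zero>\<^bsub>S\<^esub> \<in> extension J"
    by (rule extensionI[of _ \<one> \<zero>]) auto
  show ?thesis
  proof (rule idealI)
    show "subgroup (extension J) (add_monoid S)"
    proof
      show "extension J \<subseteq> carrier (add_monoid S)" by (auto simp: extension_def)
      fix x assume x: "x \<in> extension J"
      then have c: "x \<in> carrier S" by (auto simp: extension_def)
      \<comment> \<open>Negation is multiplication by minus one, so the closure under multiples
        already proved covers it.\<close>
      have "(\<ominus>\<^bsub>S\<^esub> \<one>\<^bsub>S\<^esub>) \<otimes>\<^bsub>S\<^esub> x \<in> extension J" using x by (intro mult) auto
      then show "inv\<^bsub>add_monoid S\<^esub> x \<in> extension J"
        using c by (simp add: S.l_minus a_inv_def[symmetric])
    qed (use add zero in auto)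
    show "x \<otimes>\<^bsub>S\<^esub> a \<in> extension J" if "a \<in> extension J" "x \<in> carrier S" for a x
      using that by (rule mult)
    show "a \<otimes>\<^bsub>S\<^esub> x \<in> extension J" if "a \<in> extension J" "x \<in> carrier S" for a x
      using mult[OF that] that S.m_comm[of a x] by (auto simp: extension_def)
  qed (rule S.ring_axioms)
qed

lemma ideal_contraction:
  assumes "ideal I S"
  shows "ideal (contraction I) R"
proof -
  interpret I: ideal I S by fact
  show ?thesis
  proof (rule idealI)
    show "subgroup (contraction I) (add_monoid R)"
    proof (rule R.add.subgroupI)
      have "\<zero> \<in> contraction I"
        unfolding contraction_def mem_Collect_eq hom_zero by (intro conjI R.zero_closed I.zero_closed)
      then show "contraction I \<noteq> {}" by blast
      fix x assume x: "x \<in> contraction I"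
      then show "\<ominus> x \<in> contraction I"
        by (simp add: contraction_def)
      show "x \<oplus> y \<in> contraction I" if "y \<in> contraction I" for y
        using x that by (simp add: contraction_def)
    qed (simp add: contraction_def)
  qed (simp_all add: contraction_def I.I_l_closed I.I_r_closed R.ring_axioms)
qed

text \<open>Multiplication by a unit neither creates nor destroys membership in an ideal, so
  \<open>x\<close> lies in \<open>I\<close> exactly when its numerator \<open>h r\<close>
  does.\<close>

lemma extension_contraction:
  assumes "ideal I S"
  shows "extension (contraction I) = I"
proof (intro equalityI subsetI)
  interpret I: ideal I S by fact
  fix x
  {
    assume "x \<in> extension (contraction I)"
    then show "x \<in> I"
      by (rule extensionE) (auto simp: contraction_def intro: mem_ideal_unit_cancel[OF assms])
  next
    assume x: "x \<in> I"
    then have c: "x \<in> carrier S" by simp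
    then obtain s r where "s \<in> carrier R" "h s \<in> Units S" "r \<in> carrier R" "h s \<otimes>\<^bsub>S\<^esub> x = h r"
      by (rule denominatorE)
    moreover from this have "h r \<in> I"
      using I.I_l_closed[OF x, of "h s"] by simp
    ultimately show "x \<in> extension (contraction I)"
      using c by (auto intro: extensionI simp: contraction_def)
  }
qed

lemma hom_mem_extension:
  assumes "ideal J R" "j \<in> J"
  shows "h j \<in> extension J"
proof -
  interpret J: ideal J R by fact
  show ?thesis using assms(2) by (intro extensionI[of _ \<one> j]) auto
qed

lemma extension_carrier: "extension (carrier R) = carrier S"
  using ex_denominator by (auto simp: extension_def)

text \<open>From left to right, \<open>h\<close> sends generators \<open>i \<otimes> j\<close> to
  products of extended elements, and the unit denominator cancels. From right to left, the
  denominators of the two factors are multiplied.\<close>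

lemma extension_ideal_prod:
  assumes "ideal I R" "ideal J R"
  shows "extension (ideal_prod R I J) = ideal_prod S (extension I) (extension J)"
proof (intro equalityI subsetI)
  have IJ: "ideal (ideal_prod R I J) R"
    using assms by (rule R.ideal_prod_is_ideal)
  have E: "ideal (ideal_prod S (extension I) (extension J)) S"
    using assms by (intro S.ideal_prod_is_ideal ideal_extension)
  fix x
  {
    \<comment> \<open>Membership in \<open>carrier R\<close> is carried through the induction
      because additivity of \<open>h\<close> at a sum requires it of both summands.\<close>
    have "k \<in> carrier R \<and> h k \<in> ideal_prod S (extension I) (extension J)"
      if "k \<in> ideal_prod R I J" for k
      using that
    proof induction
      case (prod i j)
      then have "i \<in> carrier R" "j \<in> carrier R"
        using assms by (auto simp: ideal.Icarr)
      then show ?case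
        using prod assms by (auto intro: ideal_prod.prod hom_mem_extension)
    qed (auto intro: ideal_prod.sum)
    moreover assume "x \<in> extension (ideal_prod R I J)"
    ultimately show "x \<in> ideal_prod S (extension I) (extension J)"
      by (auto elim!: extensionE intro: mem_ideal_unit_cancel[OF E])
  next
    assume "x \<in> ideal_prod S (extension I) (extension J)"
    then show "x \<in> extension (ideal_prod R I J)"
    proof induction
      case (prod x y)
      obtain s i where x: "x \<in> carrier S" "s \<in> carrier R" "h s \<in> Units S" "i \<in> I"
          "h s \<otimes>\<^bsub>S\<^esub> x = h i"
        using prod(1) by (rule extensionE)
      obtain t j where y: "y \<in> carrier S" "t \<in> carrier R" "h t \<in> Units S" "j \<in> J"
          "h t \<otimes>\<^bsub>S\<^esub> y = h j"
        using prod(2) by (rule extensionE)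
      have c: "i \<in> carrier R" "j \<in> carrier R"
        using x y assms by (auto simp: ideal.Icarr)
      have "h (s \<otimes> t) \<otimes>\<^bsub>S\<^esub> (x \<otimes>\<^bsub>S\<^esub> y) = (h s \<otimes>\<^bsub>S\<^esub> x) \<otimes>\<^bsub>S\<^esub> (h t \<otimes>\<^bsub>S\<^esub> y)"
        using x(1,2) y(1,2) by (simp add: S.m_ac)
      also have "\<dots> = h (i \<otimes> j)" using x y c by simp
      finally show ?case
        using x y
        by (intro extensionI[of _ "s \<otimes> t" "i \<otimes> j"]) (auto intro: ideal_prod.prod)
    next
      case (sum x y)
      interpret X: ideal "extension (ideal_prod R I J)" S
        using IJ by (rule ideal_extension)
      show ?case using sum by simp
    qed
  }
qed

lemma extension_foldr_ideal_prod:
  assumes "\<And>J. J \<in> set Js \<Longrightarrow> ideal J R"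
  shows "extension (foldr (ideal_prod R) Js (carrier R))
    = foldr (ideal_prod S) (map extension Js) (carrier S)"
  using assms
  by (induction Js)
    (simp_all add: extension_carrier extension_ideal_prod R.ideal_foldr_ideal_prod)

section \<open>Extension of 2-absorbing ideals\<close>

lemma hom_eq_diff_mem_kernel:
  assumes "x \<in> carrier R" "y \<in> carrier R" "h x = h y"
  shows "x \<ominus> y \<in> a_kernel R S h"
proof -
  have "h (x \<ominus> y) = h x \<oplus>\<^bsub>S\<^esub> \<ominus>\<^bsub>S\<^esub> h y"
    using assms(1,2) by (simp add: R.minus_eq)
  also have "\<dots> = \<zero>\<^bsub>S\<^esub>"
    unfolding assms(3) using assms(2) by (intro S.r_neg) simp
  finally show ?thesis
    unfolding a_kernel_def' using assms(1,2) by blast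
qed

text \<open>Clearing denominators turns the hypothesis on \<open>x\<close>, \<open>y\<close>,
  \<open>z\<close> into one on numerators in \<open>R\<close>, valid modulo the kernel and hence
  modulo \<open>J\<close>. The 2-absorbing property of \<open>J\<close> then applies, and dividing
  by units returns to the target. Properness is not claimed: the extension may be the unit
  ideal.\<close>

lemma TA_ideal_extension:
  assumes TA: "TA_ideal J R" and ker: "a_kernel R S h \<subseteq> J"
  shows "TA_ideal (extension J) S"
  unfolding TA_ideal_def
proof (intro conjI ballI impI)
  have J: "ideal J R" using TA by (simp add: TA_ideal_def)
  interpret J: ideal J R by fact
  show "ideal (extension J) S" using J by (rule ideal_extension)
  fix x y z assume x: "x \<in> carrier S" and y: "y \<in> carrier S" and z: "z \<in> carrier S"
    and xyz: "x \<otimes>\<^bsub>S\<^esub> y \<otimes>\<^bsub>S\<^esub> z \<in> extension J"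
  obtain s a where s: "s \<in> carrier R" "h s \<in> Units S" "a \<in> carrier R" "h s \<otimes>\<^bsub>S\<^esub> x = h a"
    using x by (rule denominatorE)
  obtain t b where t: "t \<in> carrier R" "h t \<in> Units S" "b \<in> carrier R" "h t \<otimes>\<^bsub>S\<^esub> y = h b"
    using y by (rule denominatorE)
  obtain r c where r: "r \<in> carrier R" "h r \<in> Units S" "c \<in> carrier R" "h r \<otimes>\<^bsub>S\<^esub> z = h c"
    using z by (rule denominatorE)
  note u = s(2) t(2) r(2) and eq = s(4) t(4) r(4) and c = x y z s(1,3) t(1,3) r(1,3)
  \<comment> \<open>\<open>w\<close> is a denominator of the whole product with numerator in
    \<open>J\<close>; it need not be related to \<open>s\<close>, \<open>t\<close>,
    \<open>r\<close>.\<close>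
  obtain w j where w: "w \<in> carrier R" "h w \<in> Units S" "j \<in> J"
      "h w \<otimes>\<^bsub>S\<^esub> (x \<otimes>\<^bsub>S\<^esub> y \<otimes>\<^bsub>S\<^esub> z) = h j"
    using xyz by (rule extensionE)
  have "h (w \<otimes> a \<otimes> b \<otimes> c) = h w \<otimes>\<^bsub>S\<^esub> (h s \<otimes>\<^bsub>S\<^esub> x) \<otimes>\<^bsub>S\<^esub> (h t \<otimes>\<^bsub>S\<^esub> y) \<otimes>\<^bsub>S\<^esub> (h r \<otimes>\<^bsub>S\<^esub> z)"
    using c w eq by simp
  also have "\<dots> = h s \<otimes>\<^bsub>S\<^esub> h t \<otimes>\<^bsub>S\<^esub> h r \<otimes>\<^bsub>S\<^esub> (h w \<otimes>\<^bsub>S\<^esub> (x \<otimes>\<^bsub>S\<^esub> y \<otimes>\<^bsub>S\<^esub> z))"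
    using c w(1) by (simp add: S.m_ac)
  also have "\<dots> = h (s \<otimes> t \<otimes> r \<otimes> j)"
    using c w by simp
  finally have "w \<otimes> a \<otimes> b \<otimes> c \<ominus> s \<otimes> t \<otimes> r \<otimes> j \<in> a_kernel R S h"
    using c w(1) J.Icarr[OF w(3)] by (intro hom_eq_diff_mem_kernel) auto
  \<comment> \<open>The difference lies in \<open>J\<close> by the kernel hypothesis, and the
    subtracted term is a multiple of \<open>j\<close>; adding it back isolates the product of the
    numerators.\<close>
  then have "(w \<otimes> a \<otimes> b \<otimes> c \<ominus> s \<otimes> t \<otimes> r \<otimes> j) \<oplus> s \<otimes> t \<otimes> r \<otimes> j \<in> J"
    using ker c w(1) J.I_l_closed[OF w(3)] by (intro J.a_closed) auto
  then have "w \<otimes> a \<otimes> b \<otimes> c \<in> J"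
    using c w(1) J.Icarr[OF w(3)] by (simp add: R.minus_eq R.a_assoc R.l_neg)
  \<comment> \<open>The 2-absorbing property is applied to the triple \<open>w \<otimes> a\<close>,
    \<open>b\<close>, \<open>c\<close>. The extra factor \<open>w\<close> is harmless, since
    \<open>h w\<close> is a unit and joins the denominator.\<close>
  then have "w \<otimes> a \<otimes> b \<in> J \<or> w \<otimes> a \<otimes> c \<in> J \<or> b \<otimes> c \<in> J"
    using TA c w unfolding TA_ideal_def by blast
  moreover have "x \<otimes>\<^bsub>S\<^esub> y \<in> extension J" if "w \<otimes> a \<otimes> b \<in> J"
  proof (rule extensionI[OF _ _ _ that])
    show "h (w \<otimes> s \<otimes> t) \<otimes>\<^bsub>S\<^esub> (x \<otimes>\<^bsub>S\<^esub> y) = h (w \<otimes> a \<otimes> b)"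
      using c w(1) by (simp add: eq[symmetric] S.m_ac)
  qed (use c w u in auto)
  moreover have "x \<otimes>\<^bsub>S\<^esub> z \<in> extension J" if "w \<otimes> a \<otimes> c \<in> J"
  proof (rule extensionI[OF _ _ _ that])
    show "h (w \<otimes> s \<otimes> r) \<otimes>\<^bsub>S\<^esub> (x \<otimes>\<^bsub>S\<^esub> z) = h (w \<otimes> a \<otimes> c)"
      using c w(1) by (simp add: eq[symmetric] S.m_ac)
  qed (use c w u in auto)
  moreover have "y \<otimes>\<^bsub>S\<^esub> z \<in> extension J" if "b \<otimes> c \<in> J"
  proof (rule extensionI[OF _ _ _ that])
    show "h (t \<otimes> r) \<otimes>\<^bsub>S\<^esub> (y \<otimes>\<^bsub>S\<^esub> z) = h (b \<otimes> c)"
      using c by (simp add: eq[symmetric] S.m_ac)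
  qed (use c u in auto)
  ultimately show "x \<otimes>\<^bsub>S\<^esub> y \<in> extension J \<or> x \<otimes>\<^bsub>S\<^esub> z \<in> extension J \<or> y \<otimes>\<^bsub>S\<^esub> z \<in> extension J"
    by blast
qed

section \<open>Transfer of TA-factorizations to the target\<close>

lemma TAF_ring_target:
  assumes "TAF_ring R"
  shows "TAF_ring S"
  unfolding TAF_ring_def
proof (intro conjI allI impI)
  show "cring S" by (rule S.cring_axioms)
  fix I assume "ideal I S \<and> I \<noteq> carrier S"
  then have I: "ideal I S" and proper: "I \<noteq> carrier S" by auto
  interpret I: ideal I S by fact
  let ?K = "contraction I"
  \<comment> \<open>Otherwise \<open>I\<close>, the extension of \<open>?K\<close>, would be all of
    \<open>carrier S\<close>.\<close>
  have "?K \<noteq> carrier R"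
    using extension_contraction[OF I] extension_carrier proper by auto
  then have "\<exists>Js. TA_factorization R ?K Js"
    using assms ideal_contraction[OF I] by (simp add: TAF_ring_def)
  then obtain Js where Js: "\<And>J. J \<in> set Js \<Longrightarrow> TA_ideal J R"
      and K: "?K = foldr (ideal_prod R) Js (carrier R)"
    unfolding TA_factorization_def by blast
  have ideals: "ideal J R" if "J \<in> set Js" for J
    using Js[OF that] by (simp add: TA_ideal_def)
  have "a_kernel R S h \<subseteq> ?K"
    by (auto simp only: a_kernel_def' contraction_def I.zero_closed)
  then have TA: "TA_ideal (extension J) S" if "J \<in> set Js" for J
    using R.foldr_ideal_prod_subset[OF ideals that] K Js[OF that]
    by (intro TA_ideal_extension) auto
  let ?Es = "filter (\<lambda>J. J \<noteq> carrier S) (map extension Js)"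
  have "I = foldr (ideal_prod S) (map extension Js) (carrier S)"
    using extension_foldr_ideal_prod[of Js] extension_contraction[OF I] K ideals by simp
  also have "\<dots> = foldr (ideal_prod S) ?Es (carrier S)"
    using ideals by (intro S.foldr_ideal_prod_filter[symmetric]) (auto intro: ideal_extension)
  finally have I_eq: "I = foldr (ideal_prod S) ?Es (carrier S)" .
  \<comment> \<open>The empty product is the unit ideal, so properness of \<open>I\<close>
    guarantees that some factor survives the filter.\<close>
  then have "?Es \<noteq> []" using proper by (metis foldr_Nil id_apply)
  then have "TA_factorization S I ?Es"
    unfolding TA_factorization_def using TA I_eq by auto
  then show "\<exists>Js. TA_factorization S I Js" ..
qed

end

section \<open>Quotient rings and rings of fractions as instances\<close>

text \<open>The quotient map is surjective, so the denominator can always be one.\<close>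

lemma fraction_hom_Quot:
  assumes "cring R" "ideal I R"
  shows "fraction_hom R (R Quot I) (\<lambda>r. I +>\<^bsub>R\<^esub> r)"
proof -
  interpret R: cring R by fact
  interpret I: ideal I R by fact
  interpret Q: ring_hom_cring R "R Quot I" "\<lambda>r. I +>\<^bsub>R\<^esub> r"
    using assms(1) by (rule I.rcos_ring_hom_cring)
  show ?thesis
  proof
    fix X assume X: "X \<in> carrier (R Quot I)"
    then obtain r where "r \<in> carrier R" "X = I +>\<^bsub>R\<^esub> r"
      by (auto simp: FactRing_def A_RCOSETS_def' simp del: Q.hom_one)
    then have "\<exists>r\<in>carrier R. (I +>\<^bsub>R\<^esub> \<one>\<^bsub>R\<^esub>) \<otimes>\<^bsub>R Quot I\<^esub> X = I +>\<^bsub>R\<^esub> r"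
      by auto
    then show "\<exists>s\<in>carrier R. I +>\<^bsub>R\<^esub> s \<in> Units (R Quot I) \<and>
        (\<exists>r\<in>carrier R. (I +>\<^bsub>R\<^esub> s) \<otimes>\<^bsub>R Quot I\<^esub> X = I +>\<^bsub>R\<^esub> r)"
      by (rule_tac x = "\<one>\<^bsub>R\<^esub>" in bexI) auto
  qed
qed

text \<open>A fraction \<open>a/s\<close> has the denominator \<open>s\<close>: the image
  \<open>s/1\<close> is a unit with inverse \<open>1/s\<close>, and \<open>s/1\<close> times
  \<open>a/s\<close> is \<open>a/1\<close>. These equalities of fractions hold with the auxiliary
  factor \<open>u\<close> equal to one.\<close>

lemma fraction_hom_fraction_ring:
  assumes "cring R" "submonoid S R"
  shows "fraction_hom R (fraction_ring R S) (\<lambda>r. frac R S r \<one>\<^bsub>R\<^esub>)"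
proof -
  interpret R: cring R by fact
  interpret S: submonoid S R by fact
  interpret F: cring "fraction_ring R S" using assms by (rule cring_fraction_ring)
  note ops = mult_frac[OF assms] add_frac[OF assms] frac_closed[OF assms]
    frac_eq_iff[OF assms]
  have one: "\<one>\<^bsub>fraction_ring R S\<^esub> = frac R S \<one>\<^bsub>R\<^esub> \<one>\<^bsub>R\<^esub>"
    by (simp add: fraction_ring_def)
  interpret Q: ring_hom_cring R "fraction_ring R S" "\<lambda>r. frac R S r \<one>\<^bsub>R\<^esub>"
    by unfold_locales (auto simp: ring_hom_def ops one)
  show ?thesis
  proof
    fix X assume "X \<in> carrier (fraction_ring R S)"
    then obtain a s where X: "a \<in> carrier R" "s \<in> S" "X = frac R S a s"
      by (rule carrier_fraction_ring_cases[OF assms])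
    have "frac R S s \<one>\<^bsub>R\<^esub> \<otimes>\<^bsub>fraction_ring R S\<^esub> frac R S \<one>\<^bsub>R\<^esub> s = \<one>\<^bsub>fraction_ring R S\<^esub>"
      using X by (auto simp: ops one simp del: Q.hom_one intro!: bexI[of _ "\<one>\<^bsub>R\<^esub>"])
    then have "frac R S s \<one>\<^bsub>R\<^esub> \<in> Units (fraction_ring R S)"
      using F.m_comm[of "frac R S s \<one>\<^bsub>R\<^esub>" "frac R S \<one>\<^bsub>R\<^esub> s"] frac_closed[OF assms] X(2)
      unfolding Units_def by (metis (mono_tags, lifting) R.one_closed S.mem_carrier S.one_closed mem_Collect_eq)
    moreover have "frac R S s \<one>\<^bsub>R\<^esub> \<otimes>\<^bsub>fraction_ring R S\<^esub> X = frac R S a \<one>\<^bsub>R\<^esub>"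
      using X by (auto simp: ops intro!: bexI[of _ "\<one>\<^bsub>R\<^esub>"])
    ultimately show "\<exists>s\<in>carrier R. frac R S s \<one>\<^bsub>R\<^esub> \<in> Units (fraction_ring R S) \<and>
        (\<exists>r\<in>carrier R. frac R S s \<one>\<^bsub>R\<^esub> \<otimes>\<^bsub>fraction_ring R S\<^esub> X = frac R S r \<one>\<^bsub>R\<^esub>)"
      using X(1) S.mem_carrier[OF X(2)] by blast
  qed
qed

theorem proposition2p3:
  fixes R :: "('a, 'b) ring_scheme"
  assumes "TAF_ring R"
  shows "(\<forall>I. ideal I R \<longrightarrow> TAF_ring (R Quot I)) \<and>
         (\<forall>S. submonoid S R \<longrightarrow> TAF_ring (fraction_ring R S))"
proof -
  have R: "cring R" using assms by (simp add: TAF_ring_def)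
  show ?thesis
    using fraction_hom.TAF_ring_target[OF fraction_hom_Quot[OF R] assms]
      fraction_hom.TAF_ring_target[OF fraction_hom_fraction_ring[OF R] assms]
    by blast
qed

end
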